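(* Let $G$ be a finite quiver whose edges carry independent parameters $\{\beta_\varepsilon\}_{\varepsilon\in E_G}$. Then, for every $\varepsilon\in E_G$, $$2\,\frac{\partial}{\partial\beta_\varepsilon}\,\omega_c(G)=\omega_c(G_{\setminus\varepsilon}),$$ where $G_{\setminus\varepsilon}$ is the quiver obtained from $G$ by deleting the edge $\varepsilon$ and retaining all vertices.
   Context: All quivers are finite. A quiver $G=(V_G,E_G,\rho_G)$ consists of finite sets $V_G,E_G$ and a map $\rho_G:E_G\to V_G\times V_G$; $\rho_G(\varepsilon)=(u,v)$ means $\varepsilon$ is directed from $u$ to $v$, written $\varepsilon:u\to v$. Parallel edges, directed cycles and tadpoles (edges $u\to u$) are allowed. $G$ is connected if $V_G\neq\emptyset$ and its underlying undirected graph is connected; otherwise it is called disconnected. Acyclic means without directed cycles (a tadpole is a directed cycle). Fix a field $\Bbbk$ of characteristic zero. Each edge $\varepsilon$ carries a parameter $\beta_\varepsilon$; these are independent indeterminates, and graph functions of $G$ take values in $\Bbbk[\beta_\varepsilon:\varepsilon\in E_G]$. Edges surviving in a subquiver, deletion or contraction keep their parameters. Put $\beta_{\varepsilon,\pm}=(\beta_\varepsilon\pm1)/2$. A cut-subquiver $H\preceq G$ has vertex set $V_G$ and an arbitrary edge subset $E_H\subseteq E_G$. The contraction $G/H$ has as vertices the connected components of $H$ and as edges $E_G\setminus E_H$ with induced incidences (an edge with both endpoints in one component becomes a tadpole). The function $e$: let $E_{\mathrm{tad}}(G)$ be the set of tadpoles and $G_{\mathrm{pruned}}$ the quiver obtained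 by deleting all tadpoles. For tadpole-free $G$, $e_0(G)=|\operatorname{LE}(G)|/|V_G|!$ if $G$ is acyclic ($\operatorname{LE}(G)$ = set of linear extensions of the partial order on $V_G$ induced by the edges), and $e_0(G)=0$ otherwise. In general $e(G)=\bigl(\prod_{\varepsilon\in E_{\mathrm{tad}}(G)}(-\beta_{\varepsilon,-})\bigr)e_0(G_{\mathrm{pruned}})$. The function $\omega$ is the unique function on quivers with $\sum_{H\preceq G}\omega(H)\,e(G/H)=\epsilon(G)$ for all $G$, where $\epsilon(G)=1$ if $E_G=\emptyset$ and $0$ otherwise. The connected function is $\omega_c(G)=\omega(G)$ if $G$ is connected and $\omega_c(G)=0$ otherwise. *)

theory Defs
  imports
    "Graph_Theory.Digraph_Component"
    "HOL-Library.Poly_Mapping"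
begin

text \<open>
  A finite quiver is a \<open>fin_digraph\<close>: a finite vertex set, a finite set of
  named arcs, loops and parallel arcs allowed.  The parameter of an arc is the indeterminate
  indexed by the name of that arc, so it is automatically kept under deletion and contraction.
\<close>

section \<open>Polynomials in the edge parameters\<close>

text \<open>Finitely supported maps from monomials (exponent vectors) to coefficients.\<close>

type_synonym ('e, 'k) mpoly = "('e \<Rightarrow>\<^sub>0 nat) \<Rightarrow>\<^sub>0 'k"

definition const :: "'k::comm_ring_1 \<Rightarrow> ('e, 'k) mpoly" where
  "const c = Poly_Mapping.single 0 c"

definition beta :: "'e \<Rightarrow> ('e, 'k::comm_ring_1) mpoly" where
  "beta x = Poly_Mapping.single (Poly_Mapping.single x 1) 1"

definition beta_minus :: "'e \<Rightarrow> ('e, 'k::field_char_0) mpoly" where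
  "beta_minus x = const (1 / 2) * (beta x - 1)"

text \<open>The truncated subtraction in the exponent only occurs with coefficient 0.\<close>

definition partial_deriv :: "'e \<Rightarrow> ('e, 'k::comm_ring_1) mpoly \<Rightarrow> ('e, 'k) mpoly" where
  "partial_deriv x p =
     (\<Sum>m \<in> Poly_Mapping.keys p.
        Poly_Mapping.single (m - Poly_Mapping.single x 1)
          (of_nat (Poly_Mapping.lookup m x) * Poly_Mapping.lookup p m))"


section \<open>Contraction\<close>

text \<open>
  Cut-subquivers of \<open>G\<close> are the \<open>H\<close> with \<open>spanning H G\<close>.  A connected component of \<open>H\<close>,
  i.e. a strongly connected component of the underlying symmetric graph of \<open>H\<close>, is
  represented by its set of vertices.
\<close>

definition contraction :: "('v, 'e) pre_digraph \<Rightarrow> ('v, 'e) pre_digraph \<Rightarrow> ('v set, 'e) pre_digraph" where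
  "contraction G H =
     \<lparr> verts = pre_digraph.sccs_verts (with_proj (mk_symmetric H)),
       arcs = arcs G - arcs H,
       tail = (\<lambda>x. pre_digraph.scc_of (with_proj (mk_symmetric H)) (tail G x)),
       head = (\<lambda>x. pre_digraph.scc_of (with_proj (mk_symmetric H)) (head G x)) \<rparr>"


section \<open>The graph functions\<close>

definition linear_extensions :: "('v, 'e) pre_digraph \<Rightarrow> ('v \<times> 'v) set set" where
  "linear_extensions G =
     {r. linear_order_on (verts G) r \<and> {(u, v). u \<rightarrow>\<^sup>*\<^bsub>G\<^esub> v} \<subseteq> r}"

definition acyclic_quiver :: "('v, 'e) pre_digraph \<Rightarrow> bool" where
  "acyclic_quiver G \<longleftrightarrow> (\<nexists>p. pre_digraph.cycle G p)"

definition e0_fun :: "('v, 'e) pre_digraph \<Rightarrow> 'k::field_char_0" where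
  "e0_fun G = (if acyclic_quiver G
               then of_nat (card (linear_extensions G)) / fact (card (verts G)) else 0)"

definition tadpoles :: "('v, 'e) pre_digraph \<Rightarrow> 'e set" where
  "tadpoles G = {x \<in> arcs G. tail G x = head G x}"

definition pruned :: "('v, 'e) pre_digraph \<Rightarrow> ('v, 'e) pre_digraph" where
  "pruned G = G\<lparr>arcs := arcs G - tadpoles G\<rparr>"

definition e_fun :: "('v, 'e) pre_digraph \<Rightarrow> ('e, 'k::field_char_0) mpoly" where
  "e_fun G = (\<Prod>x \<in> tadpoles G. - beta_minus x) * const (e0_fun (pruned G))"

definition eps_fun :: "('v, 'e) pre_digraph \<Rightarrow> ('e, 'k::field_char_0) mpoly" where
  "eps_fun G = (if arcs G = {} then 1 else 0)"

definition is_omega :: "(('v, 'e) pre_digraph \<Rightarrow> ('e, 'k::field_char_0) mpoly) \<Rightarrow> bool" where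
  "is_omega w \<longleftrightarrow>
     (\<forall>G. fin_digraph G \<longrightarrow> (\<Sum>H | spanning H G. w H * e_fun (contraction G H)) = eps_fun G)"

text \<open>
  Uniqueness is uniqueness on finite quivers; the value on all other records is fixed to 0.
  Existence and uniqueness are proved in \<open>ex1_omega\<close> below.
\<close>

definition omega :: "('v, 'e) pre_digraph \<Rightarrow> ('e, 'k::field_char_0) mpoly" where
  "omega = (THE w. is_omega w \<and> (\<forall>G. \<not> fin_digraph G \<longrightarrow> w G = 0))"

definition omega_c :: "('v, 'e) pre_digraph \<Rightarrow> ('e, 'k::field_char_0) mpoly" where
  "omega_c G = (if connected G then omega G else 0)"


section \<open>Well-definedness of omega\<close>

lemma spanning_eq_image:
  assumes "fin_digraph (G :: ('v, 'e) pre_digraph)"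
  shows "{H. spanning H G} = (\<lambda>F. G\<lparr>arcs := F\<rparr>) ` Pow (arcs G)"
proof -
  interpret fin_digraph G by fact
  have "spanning (G\<lparr>arcs := F\<rparr>) G" if "F \<subseteq> arcs G" for F
  proof -
    have "wf_digraph (G\<lparr>arcs := F\<rparr>)" using that by unfold_locales auto
    then show ?thesis using that wf_digraph
      by (auto simp: spanning_def subgraph_def compatible_def)
  qed
  moreover have "H = G\<lparr>arcs := arcs H\<rparr> \<and> arcs H \<subseteq> arcs G" if "spanning H G" for H
    using that by (auto simp: spanning_def subgraph_def compatible_def)
  ultimately show ?thesis by blast
qed

lemma finite_spanning: "fin_digraph G \<Longrightarrow> finite {H. spanning H G}"
  by (simp add: spanning_eq_image fin_digraph.finite_arcs)

lemma spanning_self: "fin_digraph G \<Longrightarrow> spanning G G"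
  by (simp add: spanning_def fin_digraph_def wf_digraph.subgraph_refl)

lemma spanning_fin_digraph: "fin_digraph G \<Longrightarrow> spanning H G \<Longrightarrow> fin_digraph H"
  by (auto simp: spanning_def intro: fin_digraph.fin_digraph_subgraph)

lemma spanning_card_less:
  assumes "fin_digraph G" "spanning H G" "H \<noteq> G"
  shows "card (arcs H) < card (arcs G)"
proof (rule psubset_card_mono)
  show "finite (arcs G)" using assms(1) by (rule fin_digraph.finite_arcs)
  show "arcs H \<subset> arcs G"
    using assms(2,3) by (auto simp: spanning_def subgraph_def compatible_def)
qed

lemma acyclic_quiver_no_arcs: "arcs G = {} \<Longrightarrow> acyclic_quiver G"
  by (auto simp: acyclic_quiver_def pre_digraph.cycle_def pre_digraph.awalk_def)

lemma linear_extensions_no_arcs: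
  assumes "arcs G = {}"
  shows "linear_extensions G = {r. linear_order_on (verts G) r}"
proof -
  have "u = v \<and> u \<in> verts G" if "u \<rightarrow>\<^sup>*\<^bsub>G\<^esub> v" for u v
    using that unfolding reachable_def
    by (induction rule: rtrancl_on_induct) (use assms in \<open>auto simp: arcs_ends_def\<close>)
  then show ?thesis
    unfolding linear_extensions_def linear_order_on_def partial_order_on_def preorder_on_def
      refl_on_def by blast
qed

lemma finite_verts_contraction:
  assumes "fin_digraph G"
  shows "finite (verts (contraction G G))"
proof -
  interpret fin_digraph G by fact
  interpret S: pair_fin_digraph "mk_symmetric G" by (rule pair_fin_digraph_mk_symmetric)
  show ?thesis unfolding contraction_def by (simp add: S.finite_sccs_verts)
qed

lemma const_mult: "const a * const b = const (a * b)"
  by (simp add: const_def mult_single)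

lemma const_1: "const 1 = 1"
  by (simp add: const_def)

lemma e_fun_contraction_self:
  assumes "fin_digraph (G :: ('v, 'e) pre_digraph)"
  shows "\<exists>c::'k::field_char_0. c \<noteq> 0 \<and> e_fun (contraction G G) = const c"
proof -
  let ?Q = "contraction G G"
  have arcs: "arcs ?Q = {}" by (simp add: contraction_def)
  have tad: "tadpoles ?Q = {}" using arcs by (simp add: tadpoles_def)
  have pru: "pruned ?Q = ?Q" by (simp add: pruned_def tad)
  have fin: "finite (verts ?Q)" using assms by (rule finite_verts_contraction)
  have "finite (linear_extensions ?Q)"
    by (rule finite_subset[of _ "Pow (verts ?Q \<times> verts ?Q)"])
       (auto simp: linear_extensions_def linear_order_on_def partial_order_on_def preorder_on_def fin)
  moreover obtain r where "well_order_on (verts ?Q) r" using well_order_on by blast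
  then have "linear_extensions ?Q \<noteq> {}"
    by (auto simp: linear_extensions_no_arcs[OF arcs] well_order_on_def)
  ultimately have "card (linear_extensions ?Q) \<noteq> 0" by simp
  then have "e0_fun ?Q \<noteq> (0 :: 'k)"
    by (simp add: e0_fun_def acyclic_quiver_no_arcs arcs)
  moreover have "e_fun ?Q = (const (e0_fun ?Q) :: ('e, 'k) mpoly)"
    by (simp add: e_fun_def tad pru)
  ultimately show ?thesis by blast
qed

lemma omega_sum_split:
  fixes w :: "('v, 'e) pre_digraph \<Rightarrow> ('e, 'k::field_char_0) mpoly"
  assumes "fin_digraph G"
  shows "(\<Sum>H | spanning H G. w H * e_fun (contraction G H))
       = w G * e_fun (contraction G G)
         + (\<Sum>H | spanning H G \<and> H \<noteq> G. w H * e_fun (contraction G H))"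
proof -
  have "{H. spanning H G \<and> H \<noteq> G} = {H. spanning H G} - {G}" by auto
  then show ?thesis
    using sum.remove[OF finite_spanning[OF assms], of G "\<lambda>H. w H * e_fun (contraction G H)"]
      spanning_self[OF assms] by simp
qed

lemma is_omega_unique:
  fixes w w' :: "('v, 'e) pre_digraph \<Rightarrow> ('e, 'k::field_char_0) mpoly"
  assumes "is_omega w" "is_omega w'" "fin_digraph G"
  shows "w G = w' G"
  using assms(3)
proof (induction "card (arcs G)" arbitrary: G rule: less_induct)
  case less
  obtain c :: 'k where c: "c \<noteq> 0" "e_fun (contraction G G) = const c"
    using e_fun_contraction_self[OF less.prems] by blast
  have "(\<Sum>H | spanning H G \<and> H \<noteq> G. w H * e_fun (contraction G H))
      = (\<Sum>H | spanning H G \<and> H \<noteq> G. w' H * e_fun (contraction G H))"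
    using less by (intro sum.cong) (auto simp: spanning_card_less spanning_fin_digraph)
  moreover have "(\<Sum>H | spanning H G. w H * e_fun (contraction G H))
      = (\<Sum>H | spanning H G. w' H * e_fun (contraction G H))"
    using assms(1,2) less.prems by (simp add: is_omega_def)
  ultimately have "w G * const c = w' G * const c"
    by (simp add: omega_sum_split[OF less.prems] c(2))
  then have "w G * const c * const (inverse c) = w' G * const c * const (inverse c)" by simp
  then show ?case using c(1) by (simp add: mult.assoc const_mult const_1)
qed

lemma is_omega_exists:
  "\<exists>w :: ('v, 'e) pre_digraph \<Rightarrow> ('e, 'k::field_char_0) mpoly.
     is_omega w \<and> (\<forall>G. \<not> fin_digraph G \<longrightarrow> w G = 0)"
proof -
  define c :: "('v, 'e) pre_digraph \<Rightarrow> 'k"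
    where "c G = (SOME c. c \<noteq> 0 \<and> e_fun (contraction G G) = const c)" for G
  have c: "c G \<noteq> 0 \<and> e_fun (contraction G G) = const (c G)" if "fin_digraph G" for G
    unfolding c_def by (rule someI_ex[OF e_fun_contraction_self[OF that]])
  define F :: "(('v, 'e) pre_digraph \<Rightarrow> ('e, 'k) mpoly) \<Rightarrow> ('v, 'e) pre_digraph \<Rightarrow> ('e, 'k) mpoly"
    where "F f G = (if fin_digraph G then const (inverse (c G)) *
       (eps_fun G - (\<Sum>H | spanning H G \<and> H \<noteq> G. f H * e_fun (contraction G H))) else 0)" for f G
  let ?R = "measure (\<lambda>G :: ('v, 'e) pre_digraph. card (arcs G))"
  define w where "w = wfrec ?R F"
  have w: "w G = F w G" for G
  proof -
    have "w G = F (cut w ?R G) G"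
      unfolding w_def by (rule wfrec) simp
    also have "\<dots> = F w G"
    proof (cases "fin_digraph G")
      case True
      have "(\<Sum>H | spanning H G \<and> H \<noteq> G. cut w ?R G H * e_fun (contraction G H))
          = (\<Sum>H | spanning H G \<and> H \<noteq> G. w H * e_fun (contraction G H))"
        by (intro sum.cong) (auto simp: cut_apply spanning_card_less[OF True])
      then show ?thesis by (simp only: F_def)
    qed (simp add: F_def)
    finally show ?thesis .
  qed
  have "(\<Sum>H | spanning H G. w H * e_fun (contraction G H)) = eps_fun G" if G: "fin_digraph G" for G
  proof -
    let ?S = "\<Sum>H | spanning H G \<and> H \<noteq> G. w H * e_fun (contraction G H)"
    have "w G * e_fun (contraction G G) = const (inverse (c G)) * (eps_fun G - ?S) * const (c G)"
      using w[of G] c[OF G] G by (simp add: F_def)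
    also have "\<dots> = (const (inverse (c G)) * const (c G)) * (eps_fun G - ?S)"
      by (simp only: mult_ac)
    also have "\<dots> = eps_fun G - ?S"
      using c[OF G] by (simp add: const_mult const_1)
    finally show ?thesis by (simp add: omega_sum_split[OF G])
  qed
  moreover have "w G = 0" if "\<not> fin_digraph G" for G
    using w[of G] that by (simp add: F_def)
  ultimately show ?thesis unfolding is_omega_def by blast
qed

lemma ex1_omega:
  "\<exists>!w :: ('v, 'e) pre_digraph \<Rightarrow> ('e, 'k::field_char_0) mpoly.
     is_omega w \<and> (\<forall>G. \<not> fin_digraph G \<longrightarrow> w G = 0)"
proof -
  have "w = w'"
    if "is_omega w \<and> (\<forall>G. \<not> fin_digraph G \<longrightarrow> w G = 0)"
       "is_omega w' \<and> (\<forall>G. \<not> fin_digraph G \<longrightarrow> w' G = 0)"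
    for w w' :: "('v, 'e) pre_digraph \<Rightarrow> ('e, 'k) mpoly"
    using that by (metis ext is_omega_unique)
  then show ?thesis using is_omega_exists by blast
qed

lemma is_omega_omega: "is_omega omega"
  using theI'[OF ex1_omega] unfolding omega_def by blast

end

theory Submission
  imports Defs
begin

text \<open>
  Fix an arc \<open>x\<close> and differentiate the defining identity
  \<open>\<Sum>H. omega H * e_fun (G / H) = eps_fun G\<close> with respect to the parameter of \<open>x\<close>.  The right-hand
  side is constant.  The factor \<open>e_fun (G / H)\<close> involves the parameter of \<open>x\<close> only if \<open>x\<close> becomes a
  tadpole of \<open>G / H\<close>, and then its derivative is \<open>- 1/2\<close> times \<open>e_fun ((G / H) - x)\<close>
  (\<open>partial_deriv_e_fun\<close>).  In that case \<open>(G / H) - x\<close> is the same quiver as \<open>G / (H + x)\<close>, because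
  \<open>x\<close> joins two vertices that are already in one component of \<open>H\<close>.  Adding \<open>x\<close> matches
  the \<open>H\<close> of this kind with the cut-subquivers \<open>K = H + x\<close> containing \<open>x\<close> as an arc that is not a bridge.  Hence,
  writing \<open>\<delta> K = omega (K - x) / 2\<close> for these \<open>K\<close> and \<open>\<delta> K = 0\<close> for all others, the derivative of
  the identity reads
  \<open>\<Sum>K. (partial_deriv x (omega K) - \<delta> K) * e_fun (G / K) = 0\<close>.
  The factor \<open>e_fun (G / G)\<close> is a nonzero constant, so induction on the number of arcs gives
  \<open>partial_deriv x (omega G) = \<delta> G\<close> for every \<open>G\<close> (\<open>partial_deriv_omega\<close>).

  The theorem follows by passing to \<open>omega_c\<close>: for a connected \<open>G\<close>, the quiver \<open>G - x\<close> is connected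
  exactly if \<open>x\<close> is not a bridge (\<open>connected_del_arc_iff\<close>), and if \<open>G\<close> is disconnected, then so is
  \<open>G - x\<close>, and both sides vanish.
\<close>

section \<open>The partial derivative is a derivation\<close>

lemma mpoly_induct [case_names zero single add]:
  fixes p :: "('e, 'k::comm_ring_1) mpoly"
  assumes "P 0" and single: "\<And>m c. P (Poly_Mapping.single m c)"
    and add: "\<And>p q. P p \<Longrightarrow> P q \<Longrightarrow> P (p + q)"
  shows "P p"
proof (induction p rule: update_induct)
  case const
  then show ?case by (simp add: \<open>P 0\<close>)
next
  case (update f a b)
  have "Poly_Mapping.update a b f = f + Poly_Mapping.single a b"
    using update(1) by (intro poly_mapping_eqI)
      (auto simp: lookup_add lookup_single lookup_update when_def in_keys_iff)
  then show ?case using add[OF update.IH single] by simp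
qed

lemma partial_deriv_0 [simp]: "partial_deriv x 0 = 0"
  by (simp add: partial_deriv_def)

lemma partial_deriv_single:
  "partial_deriv x (Poly_Mapping.single m c) =
     Poly_Mapping.single (m - Poly_Mapping.single x 1) (of_nat (Poly_Mapping.lookup m x) * c)"
  by (cases "c = 0") (simp_all add: partial_deriv_def)

lemma partial_deriv_add: "partial_deriv x (p + q) = partial_deriv x p + partial_deriv x q"
  unfolding partial_deriv_def
  by (rule setsum_keys_plus_distrib) (simp_all add: distrib_left single_add)

lemma partial_deriv_const [simp]: "partial_deriv x (const c) = 0"
  by (simp add: const_def partial_deriv_single)

lemma partial_deriv_1 [simp]: "partial_deriv x 1 = 0"
  using partial_deriv_const[of x 1] by (simp add: const_1)

lemma partial_deriv_mult_single:
  "partial_deriv x (Poly_Mapping.single m c * Poly_Mapping.single n d) =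
     partial_deriv x (Poly_Mapping.single m c) * Poly_Mapping.single n d
     + Poly_Mapping.single m c * partial_deriv x (Poly_Mapping.single n d)"
proof -
  let ?x = "Poly_Mapping.single x (1::nat)"
  \<comment> \<open>Truncation of the exponent is harmless: it occurs only with coefficient zero.\<close>
  have shift: "k - ?x + l = k + l - ?x" if "Poly_Mapping.lookup k x \<noteq> 0" for k l :: "'a \<Rightarrow>\<^sub>0 nat"
    using that by (intro poly_mapping_eqI) (auto simp: lookup_add lookup_minus lookup_single when_def)
  have left: "partial_deriv x (Poly_Mapping.single m c) * Poly_Mapping.single n d =
      Poly_Mapping.single (m + n - ?x) (of_nat (Poly_Mapping.lookup m x) * c * d)"
    using shift[of m n]
    by (cases "Poly_Mapping.lookup m x = 0") (simp_all add: partial_deriv_single mult_single)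
  have right: "Poly_Mapping.single m c * partial_deriv x (Poly_Mapping.single n d) =
      Poly_Mapping.single (m + n - ?x) (of_nat (Poly_Mapping.lookup n x) * c * d)"
    using shift[of n m]
    by (cases "Poly_Mapping.lookup n x = 0")
       (simp_all add: partial_deriv_single mult_single add.commute mult_ac)
  show ?thesis
    unfolding left right
    by (simp add: mult_single partial_deriv_single lookup_add algebra_simps flip: single_add)
qed

lemma partial_deriv_mult:
  "partial_deriv x (p * q) = partial_deriv x p * q + p * partial_deriv x q"
proof (induction p rule: mpoly_induct)
  case (single m c)
  show ?case
    by (induction q rule: mpoly_induct)
       (simp_all add: partial_deriv_mult_single partial_deriv_add distrib_left)
qed (simp_all add: partial_deriv_add distrib_right)

lemma partial_deriv_minus: "partial_deriv x (- p) = - partial_deriv x p"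
  using partial_deriv_add[of x p "- p"] by (simp add: eq_neg_iff_add_eq_0 add.commute)

lemma partial_deriv_sum: "partial_deriv x (\<Sum>i\<in>I. f i) = (\<Sum>i\<in>I. partial_deriv x (f i))"
  by (induction I rule: infinite_finite_induct) (simp_all add: partial_deriv_add)

lemma partial_deriv_beta: "partial_deriv x (beta y) = (if x = y then 1 else 0)"
  by (auto simp: beta_def partial_deriv_single lookup_single)

lemma partial_deriv_beta_minus:
  "partial_deriv x (beta_minus y) = (if x = y then const (1 / 2) else 0)"
proof -
  have "partial_deriv x (beta y - 1 :: ('a, 'b) mpoly) = (if x = y then 1 else 0)"
    using partial_deriv_add[of x "beta y" "- 1"]
    by (simp add: partial_deriv_minus partial_deriv_beta)
  then show ?thesis by (simp add: beta_minus_def partial_deriv_mult)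
qed

lemma partial_deriv_prod_eq_0:
  assumes "\<And>i. i \<in> I \<Longrightarrow> partial_deriv x (f i) = 0"
  shows "partial_deriv x (\<Prod>i\<in>I. f i) = 0"
  using assms
  by (induction I rule: infinite_finite_induct) (simp_all add: partial_deriv_mult)


section \<open>The derivative of the function e\<close>

lemma partial_deriv_e_fun:
  fixes Q :: "('v, 'e) pre_digraph"
  assumes "finite (arcs Q)"
  shows "partial_deriv x (e_fun Q :: ('e, 'k::field_char_0) mpoly) =
    (if x \<in> tadpoles Q then - (const (1 / 2) * e_fun (pre_digraph.del_arc Q x)) else 0)"
proof -
  have indep: "partial_deriv x (\<Prod>y\<in>T. - beta_minus y :: ('e, 'k) mpoly) = 0"
    if "x \<notin> T" for T
    using that by (intro partial_deriv_prod_eq_0)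
      (auto simp: partial_deriv_minus partial_deriv_beta_minus)
  show ?thesis
  proof (cases "x \<in> tadpoles Q")
    case True
    have fin: "finite (tadpoles Q)" using assms by (simp add: tadpoles_def)
    have tad: "tadpoles (pre_digraph.del_arc Q x) = tadpoles Q - {x}"
      by (auto simp: tadpoles_def pre_digraph.del_arc_def)
    have "arcs Q - {x} - (tadpoles Q - {x}) = arcs Q - tadpoles Q" using True by auto
    then have pruned: "pruned (pre_digraph.del_arc Q x) = pruned Q"
      by (intro pre_digraph.equality) (simp_all add: pruned_def tad pre_digraph.del_arc_simps)
    show ?thesis
      using True prod.remove[OF fin True, of "\<lambda>y. - beta_minus y :: ('e, 'k) mpoly"]
        indep[of "tadpoles Q - {x}"]
      by (simp add: e_fun_def tad pruned partial_deriv_mult partial_deriv_minus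
          partial_deriv_beta_minus mult.assoc)
  qed (simp add: e_fun_def partial_deriv_mult indep)
qed


section \<open>Bridges\<close>

text \<open>
  An arc is a bridge if its ends lie in different components after its deletion.  Membership of
  \<open>x\<close> in \<open>arcs G\<close> is not part of the definition.
\<close>

definition bridge :: "('v, 'e) pre_digraph \<Rightarrow> 'e \<Rightarrow> bool" where
  "bridge G x \<longleftrightarrow> \<not> tail G x \<rightarrow>\<^sup>*\<^bsub>with_proj (mk_symmetric (pre_digraph.del_arc G x))\<^esub> head G x"

lemma reachable_mk_symmetric_sym:
  "u \<rightarrow>\<^sup>*\<^bsub>with_proj (mk_symmetric G)\<^esub> v \<Longrightarrow> v \<rightarrow>\<^sup>*\<^bsub>with_proj (mk_symmetric G)\<^esub> u"
  by (rule symmetric_reachable[OF symmetric_mk_symmetric])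

lemma reachable_del_arc_not_bridge:
  assumes "wf_digraph G" "\<not> bridge G x"
  shows "u \<rightarrow>\<^sup>*\<^bsub>with_proj (mk_symmetric (pre_digraph.del_arc G x))\<^esub> v
    \<longleftrightarrow> u \<rightarrow>\<^sup>*\<^bsub>with_proj (mk_symmetric G)\<^esub> v"
    (is "?L u v \<longleftrightarrow> ?R u v")
proof
  interpret G: wf_digraph G by fact
  interpret D: wf_digraph "G.del_arc x" by (rule G.wf_digraph_del_arc)
  interpret SG: pair_wf_digraph "mk_symmetric G" ..
  interpret SD: pair_wf_digraph "mk_symmetric (G.del_arc x)" ..
  have ends: "?L (tail G x) (head G x)" "?L (head G x) (tail G x)"
    using assms(2) by (auto simp: bridge_def intro: reachable_mk_symmetric_sym)
  have step: "?L a b" if "(a, b) \<in> parcs (mk_symmetric G)" for a b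
  proof -
    from that obtain y where y: "y \<in> arcs G"
      "(a, b) = (tail G y, head G y) \<or> (a, b) = (head G y, tail G y)"
      by (auto simp: parcs_mk_symmetric)
    show ?thesis
    proof (cases "y = x")
      case False
      then have "(a, b) \<in> parcs (mk_symmetric (G.del_arc x))"
        using y by (auto simp: parcs_mk_symmetric)
      then show ?thesis by (intro SD.reachable_adjI) simp
    qed (use y ends in auto)
  qed
  show "?L u v" if "?R u v"
    using that
  proof (induction rule: SG.reachable_induct)
    case base
    then show ?case by auto
  next
    case (step a b)
    then have "?L a b" using \<open>\<And>a b. (a, b) \<in> parcs (mk_symmetric G) \<Longrightarrow> ?L a b\<close> by simp
    with step show ?case by (blast intro: SD.reachable_trans)
  qed
  have "subgraph (G.del_arc x) G"
    using G.wf_digraph_axioms D.wf_digraph_axioms by (auto simp: subgraph_def compatible_def)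
  then show "?R u v" if "?L u v"
    using that by (intro pre_digraph.reachable_mono[OF that] subgraph_mk_symmetric)
qed

lemma connected_del_arc_iff:
  assumes "wf_digraph G" "x \<in> arcs G"
  shows "connected (pre_digraph.del_arc G x) \<longleftrightarrow> connected G \<and> \<not> bridge G x"
proof -
  interpret wf_digraph G by fact
  have "\<not> bridge G x" if "connected (del_arc x)"
    using that assms(2) by (auto simp: bridge_def connected_def strongly_connected_def)
  moreover have "connected (del_arc x) \<longleftrightarrow> connected G" if "\<not> bridge G x"
    using reachable_del_arc_not_bridge[OF assms(1) that]
    by (simp add: connected_def strongly_connected_def)
  ultimately show ?thesis by blast
qed


section \<open>Contraction and deletion of an arc\<close>

lemma scc_of_eq_iff:
  assumes "wf_digraph H" "u \<in> verts H"
  shows "pre_digraph.scc_of (with_proj (mk_symmetric H)) u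
       = pre_digraph.scc_of (with_proj (mk_symmetric H)) v
    \<longleftrightarrow> u \<rightarrow>\<^sup>*\<^bsub>with_proj (mk_symmetric H)\<^esub> v" (is "?scc u = ?scc v \<longleftrightarrow> ?R u v")
proof
  interpret wf_digraph H by fact
  interpret S: pair_wf_digraph "mk_symmetric H" ..
  show "?R u v" if "?scc u = ?scc v"
    using that S.in_scc_of_self[of u] assms(2) by (auto simp: S.scc_of_def)
  show "?scc u = ?scc v" if "?R u v"
    using that reachable_mk_symmetric_sym[OF that]
    by (auto simp: S.scc_of_def intro: S.reachable_trans)
qed

lemma tadpoles_contraction_iff:
  assumes "fin_digraph G" "spanning H G"
  shows "x \<in> tadpoles (contraction G H) \<longleftrightarrow>
    x \<in> arcs G - arcs H \<and> tail G x \<rightarrow>\<^sup>*\<^bsub>with_proj (mk_symmetric H)\<^esub> head G x"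
proof -
  interpret fin_digraph G by fact
  have "wf_digraph H" "verts H = verts G" using assms(2) by (auto simp: spanning_def)
  then show ?thesis
    using scc_of_eq_iff[of H "tail G x" "head G x"]
    by (cases "x \<in> arcs G") (simp_all add: tadpoles_def contraction_def)
qed

lemma contraction_del_arc:
  assumes "x \<notin> arcs H"
  shows "contraction (pre_digraph.del_arc G x) H = pre_digraph.del_arc (contraction G H) x"
  using assms by (auto simp: contraction_def pre_digraph.del_arc_def)

text \<open>
  An arc of \<open>H\<close> that is not a bridge of \<open>H\<close> does not affect the components of \<open>H\<close>.  So \<open>G / H\<close> does
  not change when such an arc is deleted from both quivers.
\<close>

lemma contraction_del_arc_not_bridge:
  assumes "wf_digraph H" "x \<in> arcs H" "\<not> bridge H x"
  shows "contraction (pre_digraph.del_arc G x) (pre_digraph.del_arc H x) = contraction G H"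
proof -
  note reach = reachable_del_arc_not_bridge[OF assms(1,3)]
  have "arcs G - {x} - (arcs H - {x}) = arcs G - arcs H" using assms(2) by auto
  then show ?thesis
    by (simp add: contraction_def pre_digraph.sccs_verts_def pre_digraph.scc_of_def reach
        pre_digraph.del_arc_simps)
qed


section \<open>The derivative of omega\<close>

text \<open>
  The value that the derivative of \<^term>\<open>omega H\<close> with respect to the parameter of \<open>x\<close> turns out
  to have.
\<close>

definition omega_deriv :: "'e \<Rightarrow> ('v, 'e) pre_digraph \<Rightarrow> ('e, 'k::field_char_0) mpoly" where
  "omega_deriv x H =
     (if x \<in> arcs H \<and> \<not> bridge H x then const (1 / 2) * omega (pre_digraph.del_arc H x) else 0)"

lemma spanning_iff:
  assumes "fin_digraph G"
  shows "spanning H G \<longleftrightarrow> arcs H \<subseteq> arcs G \<and> H = G\<lparr>arcs := arcs H\<rparr>"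
  using spanning_eq_image[OF assms] by (auto simp: set_eq_iff image_iff)

text \<open>
  The nonzero terms on the left can only come from the \<open>H\<close> that have \<open>x\<close> as an arc but not as a bridge, those
  on the right from the \<open>H\<close> for which \<open>x\<close> is a tadpole of \<open>G / H\<close>.  Deleting \<open>x\<close> maps the former
  bijectively to the latter and matches the terms.
\<close>

lemma sum_omega_deriv:
  fixes G :: "('v, 'e) pre_digraph"
  assumes "fin_digraph G"
  shows "(\<Sum>H | spanning H G. omega_deriv x H * e_fun (contraction G H)) =
    - (\<Sum>H | spanning H G. omega H *
         partial_deriv x (e_fun (contraction G H) :: ('e, 'k::field_char_0) mpoly))"
proof -
  interpret G: fin_digraph G by fact
  let ?del = "\<lambda>H. pre_digraph.del_arc H x"
  let ?A = "{H. spanning H G \<and> x \<in> arcs H \<and> \<not> bridge H x}"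
  let ?B = "{H. spanning H G \<and> x \<in> tadpoles (contraction G H)}"
  have fin: "finite (arcs (contraction G H))" for H by (simp add: contraction_def)
  have "(\<Sum>H | spanning H G. omega_deriv x H * e_fun (contraction G H)) =
      (\<Sum>H\<in>?A. const (1 / 2) * omega (?del H) * (e_fun (contraction G H) :: ('e, 'k) mpoly))"
    by (intro sum.mono_neutral_cong_right finite_spanning assms) (auto simp: omega_deriv_def)
  also have "\<dots> = (\<Sum>H\<in>?B. const (1 / 2) * omega H * e_fun (?del (contraction G H)))"
  proof (rule sum.reindex_bij_witness[where j = ?del and i = "\<lambda>H. H\<lparr>arcs := insert x (arcs H)\<rparr>"])
    fix H assume H: "H \<in> ?A"
    have fH: "fin_digraph H" using H assms by (auto intro: spanning_fin_digraph)
    then have wf: "wf_digraph H" by (simp add: fin_digraph_def)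
    have H': "arcs H \<subseteq> arcs G" "H = G\<lparr>arcs := arcs H\<rparr>" "x \<in> arcs H" "\<not> bridge H x"
      using H spanning_iff[OF assms] by auto
    then have eqs: "tail H = tail G" "head H = head G" "verts H = verts G"
      by (metis pre_digraph.select_convs pre_digraph.update_convs pre_digraph.surjective)+
    show "(?del H)\<lparr>arcs := insert x (arcs (?del H))\<rparr> = H"
      using H'(3) by (simp add: pre_digraph.del_arc_def insert_absorb)
    have sp: "spanning (?del H) G"
      unfolding spanning_iff[OF assms] using H'(1) eqs by (auto simp: pre_digraph.del_arc_def)
    then show "?del H \<in> ?B"
      using H' eqs by (auto simp: tadpoles_contraction_iff[OF assms] bridge_def
          pre_digraph.del_arc_simps)
    have "?del (contraction G (?del H)) = contraction G H"
      using contraction_del_arc[of x "?del H" G] contraction_del_arc_not_bridge[OF wf H'(3,4), of G]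
      by (simp add: pre_digraph.del_arc_simps)
    then show "const (1 / 2) * omega (?del H) * e_fun (?del (contraction G (?del H)))
      = const (1 / 2) * omega (?del H) * (e_fun (contraction G H) :: ('e, 'k) mpoly)" by simp
  next
    fix H assume "H \<in> ?B"
    then have H: "spanning H G" "x \<in> arcs G" "x \<notin> arcs H"
      "tail G x \<rightarrow>\<^sup>*\<^bsub>with_proj (mk_symmetric H)\<^esub> head G x"
      by (auto simp: tadpoles_contraction_iff[OF assms])
    let ?H = "H\<lparr>arcs := insert x (arcs H)\<rparr>"
    have H': "arcs H \<subseteq> arcs G" "H = G\<lparr>arcs := arcs H\<rparr>" using H spanning_iff[OF assms] by auto
    then have eqs: "tail H = tail G" "head H = head G" "verts H = verts G"
      by (metis pre_digraph.select_convs pre_digraph.update_convs pre_digraph.surjective)+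
    show del: "?del ?H = H" using H(3) by (simp add: pre_digraph.del_arc_def)
    have "spanning ?H G"
      unfolding spanning_iff[OF assms] using H'(1) H(2) eqs by auto
    moreover have "\<not> bridge ?H x"
      using H(4) by (simp add: bridge_def del eqs)
    ultimately show "?H \<in> ?A" by simp
  qed
  also have "\<dots> = (\<Sum>H\<in>?B. - (omega H * partial_deriv x (e_fun (contraction G H))))"
    by (intro sum.cong refl) (simp add: partial_deriv_e_fun[OF fin] mult_ac)
  also have "\<dots> = (\<Sum>H | spanning H G. - (omega H * partial_deriv x (e_fun (contraction G H))))"
    by (intro sum.mono_neutral_left finite_spanning assms)
       (auto simp: partial_deriv_e_fun[OF fin])
  finally show ?thesis by (simp add: sum_negf)
qed

lemma partial_deriv_omega:
  fixes G :: "('v, 'e) pre_digraph"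
  assumes "fin_digraph G"
  shows "partial_deriv x (omega G :: ('e, 'k::field_char_0) mpoly) = omega_deriv x G"
  using assms
proof (induction "card (arcs G)" arbitrary: G rule: less_induct)
  case less
  let ?d = "\<lambda>H. partial_deriv x (omega H) - omega_deriv x H :: ('e, 'k) mpoly"
  obtain c :: 'k where c: "c \<noteq> 0" "e_fun (contraction G G) = const c"
    using e_fun_contraction_self[OF less.prems] by blast
  have "(\<Sum>H | spanning H G. omega H * e_fun (contraction G H)) = (eps_fun G :: ('e, 'k) mpoly)"
    using is_omega_omega[where ?'a = 'v and ?'b = 'e and ?'c = 'k] less.prems
    by (simp add: is_omega_def)
  then have "partial_deriv x (\<Sum>H | spanning H G. omega H * e_fun (contraction G H)) =
      (0 :: ('e, 'k) mpoly)"
    by (simp add: eps_fun_def)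
  then have "(\<Sum>H | spanning H G. partial_deriv x (omega H) * e_fun (contraction G H)) +
      (\<Sum>H | spanning H G. omega H * partial_deriv x (e_fun (contraction G H))) =
      (0 :: ('e, 'k) mpoly)"
    by (simp add: partial_deriv_sum partial_deriv_mult sum.distrib)
  then have "(\<Sum>H | spanning H G. ?d H * e_fun (contraction G H)) = 0"
    by (simp add: left_diff_distrib sum_subtractf sum_omega_deriv[OF less.prems])
  moreover have "(\<Sum>H | spanning H G \<and> H \<noteq> G. ?d H * e_fun (contraction G H)) = 0"
    using less by (intro sum.neutral) (auto simp: spanning_card_less spanning_fin_digraph)
  ultimately have "?d G * const c = 0"
    by (simp add: omega_sum_split[OF less.prems] c(2))
  then have "?d G * (const c * const (inverse c)) = 0"
    by (simp flip: mult.assoc)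
  then show ?case using c(1) by (simp add: const_mult const_1)
qed

theorem proposition5p1:
  fixes G :: "('v, 'e) pre_digraph" and x :: 'e
  assumes "fin_digraph G" and "x \<in> arcs G"
  shows "2 * partial_deriv x (omega_c G :: ('e, 'k::field_char_0) mpoly)
           = omega_c (pre_digraph.del_arc G x)"
proof -
  have "wf_digraph G" using assms(1) by (simp add: fin_digraph_def)
  note conn = connected_del_arc_iff[OF this assms(2)]
  have "const (1 / 2) + const (1 / 2) = (1 :: ('e, 'k) mpoly)"
    by (simp add: const_def flip: single_add)
  then have half: "2 * (const (1 / 2) * p) = p" for p :: "('e, 'k) mpoly"
    by (metis mult.assoc mult_2 mult_1)
  show ?thesis
    using assms(2)
    by (auto simp: omega_c_def conn partial_deriv_omega[OF assms(1)] omega_deriv_def half)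
qed

end
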